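(* Let $N\ge 2$ be an integer and let $\mathbf v=(v_0,\dots,v_{N-1})$ be an arbitrary real vector with DCT spectrum $V_0,\dots,V_{N-1}$ and mean $\bar v=\frac1N\sum_{n=0}^{N-1}v_n$. Let $S_k$, $k=1,\dots,N-1$, be the ACT averages of $\mathbf v$ (with $\beta=0$). Then $$V_k=\sqrt{\frac N2}\left(\sum_{l=1}^{\left\lfloor\frac{N-1}{k}\right\rfloor}\mu(l)\,S_{kl}\right)-\sqrt{\frac N2}\;\bar v\;M\left(\left\lfloor\frac{N-1}{k}\right\rfloor\right),\qquad k=1,2,\ldots,N-1,$$ and $V_0=\sqrt N\,\bar v$.
   Context: The DCT spectrum of $\mathbf v=(v_0,\dots,v_{N-1})$ is $$V_k=\sqrt{\tfrac2N}\,\alpha_k\sum_{n=0}^{N-1}v_n\cos\left(\frac{\pi k(n+1/2)}{N}\right),\quad k=0,\dots,N-1,$$ where $\alpha_0=1/\sqrt2$ and $\alpha_k=1$ for $k\ge1$. For any real number $r$, the (possibly fractional index) sample $v_r$ is defined by extending the inverse DCT formula to noninteger indices: $$v_r=\sqrt{\tfrac2N}\sum_{k=0}^{N-1}\alpha_kV_k\cos\left(\frac{\pi k(r+1/2)}{N}\right).$$ The $k$th ACT average (with $\beta=0$) is $$S_k=\frac1k\sum_{m=0}^{k-1}v_{2m\frac Nk-\frac12},\quad k=1,\dots,N-1.$$ $\mu$ is the Möbius function and $M(n)=\sum_{m=1}^n\mu(m)$ is the Mertens function. *)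

theory Defs
  imports Complex_Main "HOL-Computational_Algebra.Squarefree"
begin

text \<open>
  A vector \<open>(v\<^sub>0, \<dots>, v\<^bsub>N-1\<^esub>)\<close> is a function \<open>v :: nat \<Rightarrow> real\<close> together with its length \<open>N\<close>;
  every definition below depends only on the values of \<open>v\<close> on \<open>{..<N}\<close>.
\<close>

definition dct_weight :: "nat \<Rightarrow> real" where
  "dct_weight k = (if k = 0 then 1 / sqrt 2 else 1)"

definition dct :: "nat \<Rightarrow> (nat \<Rightarrow> real) \<Rightarrow> nat \<Rightarrow> real" where
  "dct N v k =
     sqrt (2 / real N) * dct_weight k *
     (\<Sum>n<N. v n * cos (pi * real k * (real n + 1 / 2) / real N))"

text \<open>The sample \<open>v\<^sub>r\<close> at a real index \<open>r\<close>: the inverse DCT formula, with \<open>r\<close> not required to be an integer.\<close>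

definition frac_sample :: "nat \<Rightarrow> (nat \<Rightarrow> real) \<Rightarrow> real \<Rightarrow> real" where
  "frac_sample N v r =
     sqrt (2 / real N) *
     (\<Sum>k<N. dct_weight k * dct N v k * cos (pi * real k * (r + 1 / 2) / real N))"

text \<open>The averages of the arithmetic cosine transform (ACT), with \<open>\<beta> = 0\<close>.\<close>

definition act_average :: "nat \<Rightarrow> (nat \<Rightarrow> real) \<Rightarrow> nat \<Rightarrow> real" where
  "act_average N v k =
     1 / real k * (\<Sum>m<k. frac_sample N v (2 * real m * (real N / real k) - 1 / 2))"

definition vec_mean :: "nat \<Rightarrow> (nat \<Rightarrow> real) \<Rightarrow> real" where
  "vec_mean N v = 1 / real N * (\<Sum>n<N. v n)"

definition moebius_mu :: "nat \<Rightarrow> int" where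
  "moebius_mu n = (if squarefree n then (-1) ^ card (prime_factors n) else 0)"

definition mertens :: "nat \<Rightarrow> int" where
  "mertens n = (\<Sum>m=1..n. moebius_mu m)"

end

theory Submission
  imports Defs
begin

text \<open>
  At the sample points of the \<open>j\<close>-th average, the inverse DCT formula evaluates to the cosines
  \<open>cos (2 \<pi> k m / j)\<close>, the real parts of the \<open>m\<close>-th powers of a \<open>j\<close>-th root of unity.
  Averaging over \<open>m < j\<close> therefore keeps exactly the frequencies \<open>k\<close> divisible by \<open>j\<close>
  (\<open>sum_cos_roots_of_unity\<close>). The frequency \<open>0\<close> contributes the mean, so that
  \<open>S\<^sub>j - vec_mean\<close> is, up to the factor \<open>sqrt (2 / N)\<close>, the sum of the spectrum over the positive
  multiples of \<open>j\<close> below \<open>N\<close> (\<open>act_average_eq_sum_multiples\<close>).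

  Sums over multiples are inverted by the Moebius function: in \<open>\<Sum>l. \<mu>(l) (S\<^bsub>kl\<^esub> - vec_mean)\<close>
  the coefficient of \<open>V\<^bsub>kn\<^esub>\<close> is \<open>\<Sum>l | l dvd n. \<mu>(l)\<close>, which vanishes unless \<open>n = 1\<close>
  (\<open>moebius_sum_multiples\<close>). Subtracting the mean from every average produces the Mertens
  function.
\<close>

lemma moebius_mu_1 [simp]: "moebius_mu (Suc 0) = 1"
  by (simp add: moebius_mu_def)

lemma moebius_mu_prime_mult:
  assumes p: "prime p" and "\<not> p dvd d"
  shows "moebius_mu (p * d) = - moebius_mu d"
proof -
  have cop: "coprime p d" using assms by (simp add: prime_imp_coprime)
  have sq: "squarefree (p * d) \<longleftrightarrow> squarefree d"
    using cop p by (auto simp: squarefree_mult_coprime squarefree_prime dest: squarefree_multD)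
  have "d \<noteq> 0" using assms(2) by (metis dvd_0_right)
  moreover have "p \<noteq> 0" using p by auto
  ultimately have "prime_factors (p * d) = insert p (prime_factors d)"
    using p by (simp add: prime_factors_product prime_prime_factors)
  moreover have "p \<notin> prime_factors d" using assms(2) by auto
  ultimately show ?thesis by (simp add: moebius_mu_def sq)
qed

text \<open>
  For a prime \<open>p\<close> dividing \<open>n\<close>, the divisors prime to \<open>p\<close> cancel against their \<open>p\<close>-multiples;
  the remaining divisors are divisible by the square of \<open>p\<close>.
\<close>
lemma moebius_mu_divisor_sum:
  assumes "n > 0"
  shows "(\<Sum>d | d dvd n. moebius_mu d) = (if n = 1 then 1 else 0)"
proof (cases "n = 1")
  case False
  then obtain p where p: "prime p" "p dvd n" using prime_factor_nat by blast
  define A where "A = {d. d dvd n \<and> \<not> p dvd d}"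
  have fin: "finite {d. d dvd n}" using assms by simp
  then have finA: "finite A" unfolding A_def by (rule rev_finite_subset) auto
  have p0: "p > 0" using p(1) prime_gt_0_nat by blast
  have sub: "A \<union> (\<lambda>d. p * d) ` A \<subseteq> {d. d dvd n}"
    using p by (auto simp: A_def intro!: divides_mult prime_imp_coprime)
  have zero: "moebius_mu d = 0" if "d dvd n" "d \<notin> A \<union> (\<lambda>d. p * d) ` A" for d
  proof -
    from that have "p dvd d" by (auto simp: A_def)
    then obtain e where e: "d = p * e" by blast
    have "e dvd n" using that(1) e by (metis dvd_mult_right)
    moreover have "e \<notin> A" using that(2) e by blast
    ultimately have "p dvd e" by (simp add: A_def)
    then have "p ^ 2 dvd d" by (auto simp: e power2_eq_square)
    moreover have "\<not> is_unit p" using p(1) by auto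
    ultimately have "\<not> squarefree d" by (auto simp: squarefree_def)
    then show ?thesis by (simp add: moebius_mu_def)
  qed
  have "(\<Sum>d | d dvd n. moebius_mu d) = (\<Sum>d\<in>A \<union> (\<lambda>d. p * d) ` A. moebius_mu d)"
    by (rule sum.mono_neutral_right) (use fin sub zero in auto)
  also have "\<dots> = sum moebius_mu A + (\<Sum>d\<in>(\<lambda>d. p * d) ` A. moebius_mu d)"
    by (rule sum.union_disjoint) (use finA in \<open>auto simp: A_def\<close>)
  also have "(\<Sum>d\<in>(\<lambda>d. p * d) ` A. moebius_mu d) = (\<Sum>d\<in>A. moebius_mu (p * d))"
    by (subst sum.reindex) (use p0 in \<open>auto simp: inj_on_def\<close>)
  also have "\<dots> = - sum moebius_mu A"
    using p(1) by (simp add: A_def moebius_mu_prime_mult sum_negf)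
  finally show ?thesis using False by simp
next
  case True
  then have "{d. d dvd n} = {1}" by auto
  then show ?thesis using True by simp
qed

lemma sum_multiples:
  fixes f :: "nat \<Rightarrow> 'a::comm_monoid_add"
  assumes "j > 0"
  shows "(\<Sum>i=1..L div j. f (j * i)) = (\<Sum>n | n \<in> {1..L} \<and> j dvd n. f n)"
proof (rule sum.reindex_bij_witness[of _ "\<lambda>n. n div j" "\<lambda>i. j * i"])
  fix i assume i: "i \<in> {1..L div j}"
  then have "j * i \<le> j * (L div j)" by simp
  also have "\<dots> \<le> L" by simp
  finally show "j * i \<in> {n. n \<in> {1..L} \<and> j dvd n}" using i assms by simp
next
  fix n assume "n \<in> {n. n \<in> {1..L} \<and> j dvd n}"
  then show "n div j \<in> {1..L div j}" "j * (n div j) = n"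
    using assms by (auto simp: div_le_mono div_greater_zero_iff Suc_le_eq dvd_imp_le)
qed (use assms in auto)

text \<open>
  The truncation at \<open>L\<close> loses nothing: a divisor of an index \<open>n\<close> in the range is again in the
  range, so each \<open>f n\<close> still receives its complete divisor sum.
\<close>
lemma moebius_sum_multiples:
  fixes f :: "nat \<Rightarrow> real"
  assumes "L \<ge> 1"
  shows "(\<Sum>l=1..L. real_of_int (moebius_mu l) * (\<Sum>i=1..L div l. f (l * i))) = f 1"
proof -
  have "(\<Sum>l=1..L. real_of_int (moebius_mu l) * (\<Sum>i=1..L div l. f (l * i)))
      = (\<Sum>l=1..L. \<Sum>n | n \<in> {1..L} \<and> l dvd n. real_of_int (moebius_mu l) * f n)"
  proof (intro sum.cong refl)
    fix l assume "l \<in> {1..L}"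
    then have "l > 0" by simp
    show "real_of_int (moebius_mu l) * (\<Sum>i=1..L div l. f (l * i))
        = (\<Sum>n | n \<in> {1..L} \<and> l dvd n. real_of_int (moebius_mu l) * f n)"
      by (simp only: sum_multiples[OF \<open>l > 0\<close>] sum_distrib_left)
  qed
  also have "\<dots> = (\<Sum>n=1..L. \<Sum>l | l \<in> {1..L} \<and> l dvd n. real_of_int (moebius_mu l) * f n)"
    by (rule sum.swap_restrict) auto
  also have "\<dots> = (\<Sum>n=1..L. if n = 1 then f n else 0)"
  proof (intro sum.cong refl)
    fix n assume n: "n \<in> {1..L}"
    have "{l. l \<in> {1..L} \<and> l dvd n} = {l. l dvd n}"
      using n by (auto dest: dvd_imp_le intro!: Nat.gr0I simp: Suc_le_eq)
    then have "(\<Sum>l | l \<in> {1..L} \<and> l dvd n. real_of_int (moebius_mu l) * f n)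
        = real_of_int (\<Sum>l | l dvd n. moebius_mu l) * f n"
      by (simp add: sum_distrib_right)
    moreover have "n > 0" using n by simp
    ultimately show "(\<Sum>l | l \<in> {1..L} \<and> l dvd n. real_of_int (moebius_mu l) * f n)
        = (if n = 1 then f n else 0)"
      by (simp add: moebius_mu_divisor_sum del: of_int_sum)
  qed
  also have "\<dots> = f 1" using assms by (subst sum.delta) auto
  finally show ?thesis .
qed

lemma sum_cos_roots_of_unity:
  assumes "j > 0"
  shows "(\<Sum>m<j. cos (2 * pi * real k * real m / real j)) = (if j dvd k then real j else 0)"
proof -
  define z where "z = cis (2 * pi * real k / real j)"
  have "Re (z ^ m) = cos (2 * pi * real k * real m / real j)" for m
    unfolding z_def DeMoivre by (simp add: mult_ac)
  then have S: "(\<Sum>m<j. cos (2 * pi * real k * real m / real j)) = Re (\<Sum>m<j. z ^ m)"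
    by (simp add: Re_sum)
  have "z ^ j = cis (2 * pi * real k)"
    unfolding z_def DeMoivre using assms by simp
  then have zj: "z ^ j = 1" by (simp add: cis_multiple_2pi)
  show ?thesis
  proof (cases "j dvd k")
    case True
    then obtain q where "k = j * q" by blast
    then have "2 * pi * real k / real j = 2 * pi * real q" using assms by simp
    then have "z = cis (2 * pi * real q)" by (simp only: z_def)
    then have "z = 1" by (simp only: cis_multiple_2pi Ints_of_nat)
    then show ?thesis using S True by simp
  next
    case False
    have "z \<noteq> 1"
    proof
      assume "z = 1"
      then have "cos (2 * pi * real k / real j) = 1"
        unfolding z_def by (metis cis.simps(1) one_complex.simps(1))
      then obtain x :: int where "2 * pi * real k / real j = real_of_int x * 2 * pi"
        using cos_one_2pi_int by blast
      then have "real k = real_of_int x * real j"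
        using assms by (simp add: field_simps)
      then have "int k = x * int j" by (metis of_int_eq_iff of_int_mult of_int_of_nat_eq)
      then show False using False by (metis dvd_triv_right int_dvd_int_iff)
    qed
    then have "(\<Sum>m<j. z ^ m) = 0" using zj by (simp add: geometric_sum)
    then show ?thesis using S False by simp
  qed
qed

lemma dct_0:
  assumes "N > 0"
  shows "dct N v 0 = sqrt (real N) * vec_mean N v"
  using assms by (simp add: dct_def dct_weight_def vec_mean_def real_sqrt_divide field_simps)

lemma act_average_eq_sum_multiples:
  assumes N: "N > 0" and j: "j > 0"
  shows "act_average N v j = vec_mean N v + sqrt (2 / real N) * (\<Sum>i=1..(N - 1) div j. dct N v (j * i))"
proof -
  define c where "c k = dct_weight k * dct N v k" for k
  have smp: "frac_sample N v (2 * real m * (real N / real j) - 1 / 2)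
      = sqrt (2 / real N) * (\<Sum>k<N. c k * cos (2 * pi * real k * real m / real j))" for m
  proof -
    have "pi * real k * (2 * real m * (real N / real j) - 1 / 2 + 1 / 2) / real N
        = 2 * pi * real k * real m / real j" for k
      using N by (simp add: field_simps)
    then show ?thesis by (simp only: frac_sample_def c_def)
  qed
  have "(\<Sum>m<j. frac_sample N v (2 * real m * (real N / real j) - 1 / 2))
      = sqrt (2 / real N) * (\<Sum>m<j. \<Sum>k<N. c k * cos (2 * pi * real k * real m / real j))"
    by (simp only: smp sum_distrib_left)
  also have "(\<Sum>m<j. \<Sum>k<N. c k * cos (2 * pi * real k * real m / real j))
      = (\<Sum>k<N. c k * (\<Sum>m<j. cos (2 * pi * real k * real m / real j)))"
    by (subst sum.swap) (simp only: sum_distrib_left)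
  also have "\<dots> = real j * (\<Sum>k<N. if j dvd k then c k else 0)"
    unfolding sum_cos_roots_of_unity[OF j] sum_distrib_left by (intro sum.cong) auto
  also have "{..<N} = insert 0 {1..N - 1}" using N by auto
  also have "(\<Sum>k\<in>insert 0 {1..N - 1}. if j dvd k then c k else 0)
      = c 0 + (\<Sum>k=1..N - 1. if j dvd k then c k else 0)"
    by (subst sum.insert) auto
  also have "(\<Sum>k=1..N - 1. if j dvd k then c k else 0)
      = (\<Sum>k | k \<in> {1..N - 1} \<and> j dvd k. c k)"
    by (intro sum.mono_neutral_cong_right) auto
  also have "\<dots> = (\<Sum>k | k \<in> {1..N - 1} \<and> j dvd k. dct N v k)"
    by (intro sum.cong) (auto simp: c_def dct_weight_def)
  also have "\<dots> = (\<Sum>i=1..(N - 1) div j. dct N v (j * i))"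
    by (rule sum_multiples[OF j, symmetric])
  finally have "act_average N v j
      = sqrt (2 / real N) * c 0 + sqrt (2 / real N) * (\<Sum>i=1..(N - 1) div j. dct N v (j * i))"
    using j by (simp add: act_average_def distrib_left)
  moreover have "sqrt (2 / real N) * c 0 = vec_mean N v"
    using N by (simp add: c_def dct_weight_def dct_0 real_sqrt_divide)
  ultimately show ?thesis by simp
qed

theorem mainTheorem2:
  fixes N :: nat and v :: "nat \<Rightarrow> real"
  assumes "N \<ge> 2"
  shows "(\<forall>k\<in>{1..N - 1}.
            dct N v k =
              sqrt (real N / 2) *
                (\<Sum>l=1..(N - 1) div k. real_of_int (moebius_mu l) * act_average N v (k * l))
              - sqrt (real N / 2) * vec_mean N v * real_of_int (mertens ((N - 1) div k)))
         \<and> dct N v 0 = sqrt (real N) * vec_mean N v"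
proof (intro conjI ballI)
  have N: "N > 0" using assms by simp
  then show "dct N v 0 = sqrt (real N) * vec_mean N v" by (rule dct_0)
  fix k assume k: "k \<in> {1..N - 1}"
  define L where "L = (N - 1) div k"
  have L: "L \<ge> 1" using k by (simp add: L_def Suc_le_eq div_greater_zero_iff)
  have S: "act_average N v (k * l)
      = vec_mean N v + sqrt (2 / real N) * (\<Sum>i=1..L div l. dct N v (k * (l * i)))"
    if "l \<in> {1..L}" for l
    using act_average_eq_sum_multiples[OF N, of "k * l" v] k that
    by (simp add: L_def div_mult2_eq mult.assoc)
  have "(\<Sum>l=1..L. real_of_int (moebius_mu l) * act_average N v (k * l))
      = (\<Sum>l=1..L. vec_mean N v * real_of_int (moebius_mu l)
          + sqrt (2 / real N) *
              (real_of_int (moebius_mu l) * (\<Sum>i=1..L div l. dct N v (k * (l * i)))))"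
    by (intro sum.cong refl) (simp only: S, simp only: algebra_simps)
  also have "\<dots> = vec_mean N v * real_of_int (mertens L) + sqrt (2 / real N) * dct N v k"
    using moebius_sum_multiples[OF L, of "\<lambda>n. dct N v (k * n)"]
    by (simp add: sum.distrib sum_distrib_left[symmetric] mertens_def)
  finally have eq: "(\<Sum>l=1..L. real_of_int (moebius_mu l) * act_average N v (k * l))
      = vec_mean N v * real_of_int (mertens L) + sqrt (2 / real N) * dct N v k" .
  have "sqrt (real N / 2) * sqrt (2 / real N) = 1"
    using N by (simp add: real_sqrt_mult[symmetric])
  then have "dct N v k = sqrt (real N / 2) * (sqrt (2 / real N) * dct N v k)"
    by (metis mult.assoc mult_1)
  then show "dct N v k =
      sqrt (real N / 2) *
        (\<Sum>l=1..(N - 1) div k. real_of_int (moebius_mu l) * act_average N v (k * l))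
      - sqrt (real N / 2) * vec_mean N v * real_of_int (mertens ((N - 1) div k))"
    unfolding L_def[symmetric] eq by (simp add: distrib_left)
qed

end
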